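(* There exists a smooth loop on the real line (a smooth one-dimensional loop) on which no invariant right measure exists.
   Context: A quasigroup $(G,\circ)$ is a set $G$ with a binary operation $\circ$ such that for all $a,b\in G$ there exist unique $x,y\in G$ with $a\circ x=b$ and $y\circ a=b$. A loop $(G,\circ,e)$ is a quasigroup with an identity element $e$, i.e. $a\circ e=a=e\circ a$ for all $a\in G$. The associative law is not assumed. A loop on the real line is a loop with $G=\mathbb{R}$ (equivalently, up to a smooth change of variables, an open interval). It is smooth if its operations (the multiplication $(a,b)\mapsto a\circ b$ and the two divisions sending $(a,b)$ to the unique solutions $x$ of $a\circ x=b$ and $y$ of $y\circ a=b$) are infinitely differentiable. An invariant right measure on such a loop is a nonzero $\sigma$-finite Borel measure $\mu$ on $G$ such that $\mu(\{\theta\in G:\theta\circ u\in A\})=\mu(A)$ for every $u\in G$ and every Borel set $A\subseteq G$. *)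

theory Defs
  imports "HOL-Analysis.Analysis"
begin

locale quasigroup =
  fixes mul :: "'a \<Rightarrow> 'a \<Rightarrow> 'a"
  assumes ex1_right_factor: "\<exists>!x. mul a x = b"
    and ex1_left_factor: "\<exists>!y. mul y a = b"
begin

definition ldiv :: "'a \<Rightarrow> 'a \<Rightarrow> 'a"
  where "ldiv a b = (THE x. mul a x = b)"

definition rdiv :: "'a \<Rightarrow> 'a \<Rightarrow> 'a"
  where "rdiv a b = (THE y. mul y a = b)"

end

locale loop = quasigroup mul
  for mul :: "'a \<Rightarrow> 'a \<Rightarrow> 'a" +
  fixes e :: 'a
  assumes right_identity: "mul a e = a"
    and left_identity: "mul e a = a"

text \<open>
  \<open>n_times_differentiable n f\<close>: all directional derivatives of \<open>f\<close> of order less than \<open>n\<close>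
  are Frechet differentiable everywhere, and those of order \<open>n\<close> are continuous
  (i.e. \<open>f\<close> is of class \<open>C\<close>-\<open>n\<close> when the domain is finite-dimensional).
\<close>

primrec n_times_differentiable ::
  "nat \<Rightarrow> ('a::real_normed_vector \<Rightarrow> 'b::real_normed_vector) \<Rightarrow> bool"
where
  "n_times_differentiable 0 f \<longleftrightarrow> continuous_on UNIV f"
| "n_times_differentiable (Suc n) f \<longleftrightarrow>
     (\<forall>x. f differentiable (at x)) \<and>
     (\<forall>v. n_times_differentiable n (\<lambda>x. frechet_derivative f (at x) v))"

definition infinitely_differentiable ::
  "('a::real_normed_vector \<Rightarrow> 'b::real_normed_vector) \<Rightarrow> bool"
  where "infinitely_differentiable f \<longleftrightarrow> (\<forall>n. n_times_differentiable n f)"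

locale smooth_loop = loop mul e
  for mul :: "'a::real_normed_vector \<Rightarrow> 'a \<Rightarrow> 'a" and e :: 'a +
  assumes smooth_mul: "infinitely_differentiable (\<lambda>(a, b). mul a b)"
    and smooth_ldiv: "infinitely_differentiable (\<lambda>(a, b). ldiv a b)"
    and smooth_rdiv: "infinitely_differentiable (\<lambda>(a, b). rdiv a b)"

definition invariant_right_measure ::
  "('a::topological_space \<Rightarrow> 'a \<Rightarrow> 'a) \<Rightarrow> 'a measure \<Rightarrow> bool"
where
  "invariant_right_measure mul \<mu> \<longleftrightarrow>
     sets \<mu> = sets borel \<and>
     sigma_finite_measure \<mu> \<and>
     emeasure \<mu> UNIV \<noteq> 0 \<and>
     (\<forall>u. \<forall>A \<in> sets borel. emeasure \<mu> {\<theta>. mul \<theta> u \<in> A} = emeasure \<mu> A)"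

end

theory Submission
  imports Defs "HOL-Real_Asymp.Real_Asymp"
begin

text \<open>
  Take \<open>a \<circ> b = a + b + sin a \<sqdot> \<phi>(b) / 8\<close> with \<open>\<phi>(b) = exp (1 / b)\<close> for \<open>b < 0\<close> and \<open>\<phi>(b) = 0\<close>
  for \<open>b \<ge> 0\<close>. Since \<open>0 \<le> \<phi> \<le> 1\<close> and \<open>\<bar>\<phi>'\<bar> \<le> 4\<close>, both partial derivatives are at least \<open>1/2\<close>, so this
  is a smooth loop. The right translations by \<open>b \<ge> 0\<close> are ordinary translations, which forces an
  invariant \<open>\<sigma>\<close>-finite measure to be a multiple of Lebesgue measure; but the right translation by
  \<open>- 1\<close> stretches the interval from \<open>0\<close> to \<open>\<pi> / 2\<close>.
\<close>

section \<open>Calculus of infinitely differentiable functions\<close>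

text \<open>Derivatives are unique, so any explicitly computed \<open>f'\<close> may replace the
  chosen \<open>frechet_derivative\<close>. The inductions on \<open>n\<close> below run through
  this rule.\<close>

lemma n_times_differentiable_SucI:
  assumes "\<And>x. (f has_derivative f' x) (at x)"
    and "\<And>v. n_times_differentiable n (\<lambda>x. f' x v)"
  shows "n_times_differentiable (Suc n) f"
proof -
  have "frechet_derivative f (at x) = f' x" for x
    using assms(1) frechet_derivative_at by metis
  then show ?thesis
    using assms by (auto simp: differentiable_def)
qed

lemma n_times_differentiable_SucE:
  assumes "n_times_differentiable (Suc n) f"
  obtains f' where "\<And>x. (f has_derivative f' x) (at x)"
    and "\<And>v. n_times_differentiable n (\<lambda>x. f' x v)"
  using assms that[of "\<lambda>x. frechet_derivative f (at x)"]
  by (auto simp: frechet_derivative_works)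

text \<open>The product, chain and reciprocal rules leave some factors undifferentiated; this lowers
  their order to the one at which the induction hypothesis speaks.\<close>

lemma n_times_differentiable_Suc_imp:
  "n_times_differentiable (Suc n) f \<Longrightarrow> n_times_differentiable n f"
proof (induction n arbitrary: f)
  case 0
  then show ?case
    by (auto simp: continuous_on_eq_continuous_at differentiable_imp_continuous_within)
next
  case (Suc n)
  then show ?case
    by (metis n_times_differentiable_SucE n_times_differentiable_SucI)
qed

lemma n_times_differentiable_const: "n_times_differentiable n (\<lambda>x. c)"
proof (induction n arbitrary: c)
  case (Suc n)
  then show ?case
    by (intro n_times_differentiable_SucI) (auto intro: derivative_eq_intros)
qed simp

lemma n_times_differentiable_bounded_linear:
  assumes "bounded_linear f"
  shows "n_times_differentiable n f"
proof (cases n)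
  case 0
  then show ?thesis
    using assms by (simp add: linear_continuous_on)
next
  case (Suc m)
  have "n_times_differentiable (Suc m) f"
    using bounded_linear_imp_has_derivative[OF assms] n_times_differentiable_const
    by (rule n_times_differentiable_SucI)
  then show ?thesis
    using Suc by simp
qed

lemma n_times_differentiable_add:
  "n_times_differentiable n f \<Longrightarrow> n_times_differentiable n g \<Longrightarrow>
    n_times_differentiable n (\<lambda>x. f x + g x)"
proof (induction n arbitrary: f g)
  case 0
  then show ?case
    by (simp add: continuous_on_add)
next
  case (Suc n)
  obtain f' where f': "\<And>x. (f has_derivative f' x) (at x)"
    "\<And>v. n_times_differentiable n (\<lambda>x. f' x v)"
    using Suc.prems(1) by (rule n_times_differentiable_SucE) blast
  obtain g' where g': "\<And>x. (g has_derivative g' x) (at x)"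
    "\<And>v. n_times_differentiable n (\<lambda>x. g' x v)"
    using Suc.prems(2) by (rule n_times_differentiable_SucE) blast
  show ?case
    by (rule n_times_differentiable_SucI[where f' = "\<lambda>x v. f' x v + g' x v"])
      (auto intro!: has_derivative_add f' g' Suc.IH)
qed

lemma n_times_differentiable_sum:
  "(\<And>i. i \<in> I \<Longrightarrow> n_times_differentiable n (f i)) \<Longrightarrow>
    n_times_differentiable n (\<lambda>x. \<Sum>i\<in>I. f i x)"
  by (induction I rule: infinite_finite_induct)
    (auto intro: n_times_differentiable_const n_times_differentiable_add)

lemma n_times_differentiable_scaleR:
  "n_times_differentiable n f \<Longrightarrow> n_times_differentiable n g \<Longrightarrow>
    n_times_differentiable n (\<lambda>x. f x *\<^sub>R g x)"
proof (induction n arbitrary: f g)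
  case 0
  then show ?case
    by (simp add: continuous_on_scaleR)
next
  case (Suc n)
  obtain f' where f': "\<And>x. (f has_derivative f' x) (at x)"
    "\<And>v. n_times_differentiable n (\<lambda>x. f' x v)"
    using Suc.prems(1) by (rule n_times_differentiable_SucE) blast
  obtain g' where g': "\<And>x. (g has_derivative g' x) (at x)"
    "\<And>v. n_times_differentiable n (\<lambda>x. g' x v)"
    using Suc.prems(2) by (rule n_times_differentiable_SucE) blast
  show ?case
    by (rule n_times_differentiable_SucI[where f' = "\<lambda>x v. f x *\<^sub>R g' x v + f' x v *\<^sub>R g x"])
      (auto intro!: has_derivative_scaleR n_times_differentiable_add f' g' Suc.IH
        Suc.prems[THEN n_times_differentiable_Suc_imp])
qed

lemmas n_times_differentiable_mult =
  n_times_differentiable_scaleR[where 'b = real, unfolded real_scaleR_def]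

lemma n_times_differentiable_bounded_linear_compose:
  assumes "bounded_linear h"
  shows "n_times_differentiable n f \<Longrightarrow> n_times_differentiable n (\<lambda>x. h (f x))"
proof (induction n arbitrary: f)
  case 0
  then show ?case
    using assms by (simp add: bounded_linear.continuous_on)
next
  case (Suc n)
  obtain f' where f': "\<And>x. (f has_derivative f' x) (at x)"
    "\<And>v. n_times_differentiable n (\<lambda>x. f' x v)"
    using Suc.prems(1) by (rule n_times_differentiable_SucE) blast
  show ?case
    by (rule n_times_differentiable_SucI[where f' = "\<lambda>x v. h (f' x v)"])
      (auto intro!: bounded_linear.has_derivative[OF assms] f' Suc.IH)
qed

lemma n_times_differentiable_Pair:
  assumes "n_times_differentiable n f" "n_times_differentiable n g"
  shows "n_times_differentiable n (\<lambda>x. (f x, g x))"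
proof -
  \<comment> \<open>A pair is the sum of its two coordinate embeddings.\<close>
  have "bounded_linear (\<lambda>y. (y, 0))" "bounded_linear (\<lambda>z. (0, z))"
    by (auto intro!: bounded_linear_Pair bounded_linear_ident bounded_linear_zero)
  from n_times_differentiable_add[OF
      n_times_differentiable_bounded_linear_compose[OF this(1) assms(1)]
      n_times_differentiable_bounded_linear_compose[OF this(2) assms(2)]]
  show ?thesis
    by simp
qed

text \<open>In the chain rule the direction \<open>g' x v\<close> varies with \<open>x\<close>,
  whereas \<open>f'\<close> is known to be regular only for fixed directions. Expanding over
  \<open>Basis\<close> leaves fixed directions \<open>b\<close> with scalar coefficients, within
  reach of the product rule and the induction hypothesis; hence the Euclidean middle space.\<close>

lemma n_times_differentiable_compose:
  fixes f :: "'b::euclidean_space \<Rightarrow> 'c::real_normed_vector"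
    and g :: "'a::real_normed_vector \<Rightarrow> 'b"
  shows "n_times_differentiable n f \<Longrightarrow> n_times_differentiable n g \<Longrightarrow>
    n_times_differentiable n (\<lambda>x. f (g x))"
proof (induction n arbitrary: f g)
  case 0
  then show ?case
    using continuous_on_compose2[of UNIV f UNIV g] by simp
next
  case (Suc n)
  obtain f' where f': "\<And>x. (f has_derivative f' x) (at x)"
    "\<And>v. n_times_differentiable n (\<lambda>x. f' x v)"
    using Suc.prems(1) by (rule n_times_differentiable_SucE) blast
  obtain g' where g': "\<And>x. (g has_derivative g' x) (at x)"
    "\<And>v. n_times_differentiable n (\<lambda>x. g' x v)"
    using Suc.prems(2) by (rule n_times_differentiable_SucE) blast
  have "n_times_differentiable n (\<lambda>x. f' (g x) (g' x v))" for v
  proof -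
    have "n_times_differentiable n (\<lambda>x. \<Sum>b\<in>Basis. (g' x v \<bullet> b) *\<^sub>R f' (g x) b)"
      by (intro n_times_differentiable_sum n_times_differentiable_scaleR Suc.IH f'
          n_times_differentiable_bounded_linear_compose[OF bounded_linear_inner_left] g'
          Suc.prems[THEN n_times_differentiable_Suc_imp])
    moreover have "f' (g x) (g' x v) = (\<Sum>b\<in>Basis. (g' x v \<bullet> b) *\<^sub>R f' (g x) b)" for x
    proof -
      have "f' (g x) (g' x v) = f' (g x) (\<Sum>b\<in>Basis. (g' x v \<bullet> b) *\<^sub>R b)"
        by (simp add: euclidean_representation)
      also have "\<dots> = (\<Sum>b\<in>Basis. (g' x v \<bullet> b) *\<^sub>R f' (g x) b)"
        using has_derivative_linear[OF f'(1)] by (simp add: linear_sum linear_scale)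
      finally show ?thesis .
    qed
    ultimately show ?thesis
      by simp
  qed
  then show ?case
    by (intro n_times_differentiable_SucI[where f' = "\<lambda>x v. f' (g x) (g' x v)"]
        has_derivative_compose[OF g'(1) f'(1)])
qed

lemma n_times_differentiable_inverse:
  fixes f :: "'a::real_normed_vector \<Rightarrow> real"
  assumes nz: "\<And>x. f x \<noteq> 0"
  shows "n_times_differentiable n f \<Longrightarrow> n_times_differentiable n (\<lambda>x. inverse (f x))"
proof (induction n)
  case 0
  then show ?case
    using nz by (simp add: continuous_on_inverse)
next
  case (Suc n)
  obtain f' where f': "\<And>x. (f has_derivative f' x) (at x)"
    "\<And>v. n_times_differentiable n (\<lambda>x. f' x v)"
    using Suc.prems(1) by (rule n_times_differentiable_SucE) blast
  \<comment> \<open>The derivative of the reciprocal contains the reciprocal again, but only at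
    order \<open>n\<close>, where the induction hypothesis covers it.\<close>
  have "n_times_differentiable n (\<lambda>x. inverse (f x))"
    using Suc n_times_differentiable_Suc_imp by blast
  then have "n_times_differentiable n (\<lambda>x. - 1 * (inverse (f x) * f' x v * inverse (f x)))" for v
    by (intro n_times_differentiable_mult n_times_differentiable_const f')
  then have "n_times_differentiable n (\<lambda>x. - (inverse (f x) * f' x v * inverse (f x)))" for v
    by simp
  then show ?case
    by (rule n_times_differentiable_SucI[OF Deriv.has_derivative_inverse[OF nz f'(1)]])
qed

lemma n_times_differentiable_SucI_real:
  fixes f :: "real \<Rightarrow> real"
  assumes "\<And>x. (f has_real_derivative f' x) (at x)" "n_times_differentiable n f'"
  shows "n_times_differentiable (Suc n) f"
proof (rule n_times_differentiable_SucI)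
  show "(f has_derivative (*) (f' x)) (at x)" for x
    using assms(1) by (simp add: has_field_derivative_def)
  show "n_times_differentiable n (\<lambda>x. f' x * v)" for v
    using assms(2) by (intro n_times_differentiable_mult n_times_differentiable_const)
qed

lemma infinitely_differentiable_sin: "infinitely_differentiable (sin :: real \<Rightarrow> real)"
proof -
  \<comment> \<open>Differentiation shifts the phase by \<open>pi / 2\<close>, so admitting every
    \<open>a\<close> closes the family under derivatives.\<close>
  have "n_times_differentiable n (\<lambda>x::real. sin (x + a))" for n a
  proof (induction n arbitrary: a)
    case 0
    then show ?case
      by (simp add: continuous_intros)
  next
    case (Suc n)
    show ?case
    proof (rule n_times_differentiable_SucI_real[OF _ Suc])
      show "((\<lambda>x. sin (x + a)) has_real_derivative sin (x + (a + pi / 2))) (at x)" for x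
        using sin_cos_eq[of "x + a"] sin_add[of "x + a" "pi / 2"]
        by (auto intro!: derivative_eq_intros simp: add.assoc)
    qed
  qed
  from this[of _ 0] show ?thesis
    by (simp add: infinitely_differentiable_def)
qed

text \<open>
  The derivative \<open>(h, k) \<mapsto> (k - F\<^sub>1 h) / F\<^sub>2\<close> of the implicit function, evaluated along its
  graph, is as regular as \<open>G\<close> itself; so every derivative of \<open>G\<close> yields the next one.
\<close>

lemma infinitely_differentiable_implicit:
  fixes F :: "'a::euclidean_space \<times> real \<Rightarrow> real" and G :: "'a \<times> real \<Rightarrow> real"
  assumes smooth: "infinitely_differentiable F"
    and "0 < c"
    and mono: "\<And>a x y. c * \<bar>x - y\<bar> \<le> \<bar>F (a, x) - F (a, y)\<bar>"
    and G: "\<And>a b. F (a, G (a, b)) = b"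
  shows "infinitely_differentiable G"
proof -
  have diffF: "F differentiable (at p)" for p
    using smooth n_times_differentiable.simps(2) unfolding infinitely_differentiable_def by blast
  define F' where "F' p = frechet_derivative F (at p)" for p
  have F': "(F has_derivative F' p) (at p)" for p
    using diffF by (simp add: F'_def frechet_derivative_works)
  have smF': "n_times_differentiable n (\<lambda>p. F' p v)" for n v
  proof -
    have "n_times_differentiable (Suc n) F"
      using smooth unfolding infinitely_differentiable_def by blast
    then show ?thesis
      unfolding F'_def n_times_differentiable.simps(2) by blast
  qed
  \<comment> \<open>Isolates the last coordinate, the one being solved for;
    \<open>F' p (0, 1)\<close> is the partial derivative in it.\<close>
  have F'_split: "F' p (h, k) = F' p (h, 0) + k * F' p (0, 1)" for p h k
  proof -
    have "F' p (h, k) = F' p ((h, 0) + k *\<^sub>R (0, 1))"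
      by simp
    also have "\<dots> = F' p (h, 0) + k * F' p (0, 1)"
      using has_derivative_linear[OF F'] by (simp only: linear_add linear_scale real_scaleR_def)
    finally show ?thesis .
  qed
  \<comment> \<open>A vanishing partial derivative would send the difference quotients to
    \<open>0\<close>, although \<open>mono\<close> keeps their absolute values at least
    \<open>c\<close>.\<close>
  have nz: "F' (a, x) (0, 1) \<noteq> 0" for a x
  proof
    assume zero: "F' (a, x) (0, 1) = 0"
    have "((\<lambda>y. (a, y)) has_derivative (\<lambda>k. (0, k))) (at x)"
      by (auto intro!: derivative_eq_intros)
    from has_derivative_compose[OF this F']
    have "((\<lambda>y. F (a, y)) has_derivative (\<lambda>k. F' (a, x) (0, k))) (at x)" .
    moreover have "(\<lambda>k. F' (a, x) (0, k)) = (*) 0"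
    proof
      show "F' (a, x) (0, k) = 0 * k" for k
        using F'_split[of "(a, x)" 0 k] zero has_derivative_linear[OF F', of "(a, x)"]
        by (simp add: linear_0 flip: zero_prod_def)
    qed
    ultimately have "((\<lambda>y. F (a, y)) has_real_derivative 0) (at x)"
      by (simp add: has_field_derivative_def)
    then have "((\<lambda>h. (F (a, x + h) - F (a, x)) / h) \<longlongrightarrow> 0) (at 0)"
      by (simp add: DERIV_def)
    then have "((\<lambda>h. \<bar>(F (a, x + h) - F (a, x)) / h\<bar>) \<longlongrightarrow> 0) (at 0)"
      by (rule tendsto_rabs_zero)
    moreover have "c \<le> \<bar>(F (a, x + h) - F (a, x)) / h\<bar>" if "h \<noteq> 0" for h
      using mono[of "x + h" x a] that by (simp add: field_simps)
    then have "\<forall>\<^sub>F h in at 0. c \<le> \<bar>(F (a, x + h) - F (a, x)) / h\<bar>"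
      by (auto simp: eventually_at_filter)
    ultimately have "c \<le> 0"
      by (rule tendsto_lowerbound) simp
    then show False
      using \<open>0 < c\<close> by simp
  qed
  \<comment> \<open>With \<open>y = G q\<close> frozen, \<open>mono\<close> and \<open>G\<close>
    bound \<open>c * \<bar>G r - y\<bar>\<close> by \<open>\<bar>snd r - F (fst r, y)\<bar>\<close>,
    which is continuous in \<open>r\<close> and vanishes at \<open>q\<close>.\<close>
  have contG: "isCont G q" for q
  proof -
    obtain a b where q: "q = (a, b)"
      by (cases q)
    define y where "y = G (a, b)"
    have contF: "isCont F p" for p
      using diffF differentiable_imp_continuous_within by blast
    have "isCont (\<lambda>r. F (fst r, y)) q"
      by (intro isCont_o2[OF _ contF] continuous_intros)
    then have "((\<lambda>r. \<bar>snd r - F (fst r, y)\<bar> / c) \<longlongrightarrow> \<bar>snd q - F (fst q, y)\<bar> / c) (at q)"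
      by (intro tendsto_intros) (auto simp: isCont_def \<open>0 < c\<close> less_imp_neq[symmetric])
    then have "((\<lambda>r. \<bar>snd r - F (fst r, y)\<bar> / c) \<longlongrightarrow> 0) (at q)"
      by (simp add: q y_def G)
    moreover have "norm (G r - y) \<le> \<bar>snd r - F (fst r, y)\<bar> / c" for r
      using mono[of "G r" y "fst r"] G[of "fst r" "snd r"] \<open>0 < c\<close>
      by (simp add: field_simps)
    ultimately have "((\<lambda>r. G r - y) \<longlongrightarrow> 0) (at q)"
      by (intro Lim_null_comparison[of "\<lambda>r. G r - y"]) auto
    then show ?thesis
      by (simp add: isCont_def q y_def LIM_zero_iff)
  qed
  define H where "H q = (fst q, G q)" for q
  define G' where "G' q v = (snd v - F' (H q) (fst v, 0)) * inverse (F' (H q) (0, 1))" for q v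
  have nzH: "F' (H q) (0, 1) \<noteq> 0" for q
    unfolding H_def by (rule nz)
  have linG': "bounded_linear (G' q)" for q
    unfolding G'_def
    by (intro bounded_linear_mult_const bounded_linear_sub bounded_linear_snd
        bounded_linear_compose[OF has_derivative_bounded_linear[OF F']]
        bounded_linear_Pair bounded_linear_fst bounded_linear_zero)
  have derG: "(G has_derivative G' q) (at q)" for q
  proof -
    \<comment> \<open>\<open>H\<close> is a right inverse of the straightening map
      \<open>p \<mapsto> (fst p, F p)\<close>. As \<open>H\<close> is continuous and
      \<open>v \<mapsto> (fst v, G' q v)\<close> inverts the derivative of that map on the left, the
      inverse function rule applies.\<close>
    have "(H has_derivative (\<lambda>v. (fst v, G' q v))) (at q)"
    proof (rule has_derivative_inverse_basic)
      show "((\<lambda>p. (fst p, F p)) has_derivative (\<lambda>v. (fst v, F' (H q) v))) (at (H q))"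
        by (intro has_derivative_Pair has_derivative_fst has_derivative_ident F')
      show "bounded_linear (\<lambda>v. (fst v, G' q v))"
        by (intro bounded_linear_Pair bounded_linear_fst linG')
      show "(\<lambda>v. (fst v, G' q v)) \<circ> (\<lambda>v. (fst v, F' (H q) v)) = id"
      proof
        fix v :: "'a \<times> real"
        show "((\<lambda>v. (fst v, G' q v)) \<circ> (\<lambda>v. (fst v, F' (H q) v))) v = id v"
          using nzH[of q] F'_split[of "H q" "fst v" "snd v"] by (simp add: G'_def prod_eq_iff)
      qed
      show "isCont H q"
        unfolding H_def by (intro continuous_intros contG)
      show "open UNIV" "q \<in> UNIV" "(fst (H z), F (H z)) = z" for z
        using G[of "fst z" "snd z"] by (auto simp: H_def)
    qed
    from has_derivative_snd[OF this] show ?thesis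
      by (simp add: H_def)
  qed
  have "n_times_differentiable n G" for n
  proof (induction n)
    case 0
    then show ?case
      using contG by (simp add: continuous_on_eq_continuous_at)
  next
    case (Suc n)
    have "n_times_differentiable n H"
      unfolding H_def
      by (intro n_times_differentiable_Pair Suc
          n_times_differentiable_bounded_linear bounded_linear_fst)
    then have F'H: "n_times_differentiable n (\<lambda>q. F' (H q) v)" for v
      by (rule n_times_differentiable_compose[OF smF'])
    have "n_times_differentiable n
      (\<lambda>q. (snd v + - 1 * F' (H q) (fst v, 0)) * inverse (F' (H q) (0, 1)))" for v
      by (intro n_times_differentiable_mult n_times_differentiable_add
          n_times_differentiable_const n_times_differentiable_inverse nzH F'H)
    then have "n_times_differentiable n (\<lambda>q. G' q v)" for v
      by (simp add: G'_def)
    then show ?case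
      by (rule n_times_differentiable_SucI[OF derG])
  qed
  then show ?thesis
    by (simp add: infinitely_differentiable_def)
qed

section \<open>A flat function\<close>

text \<open>The powers of \<open>1 / t\<close> make the family closed under differentiation up to linear combinations.\<close>

definition flat :: "nat \<Rightarrow> real \<Rightarrow> real"
  where "flat k t = (if t > 0 then inverse t ^ k * exp (- inverse t) else 0)"

text \<open>Away from \<open>0\<close>, \<open>flat k\<close> agrees locally with a single formula.
  At \<open>0\<close> the right difference quotient tends to \<open>0\<close> because
  \<open>exp (- inverse h)\<close> beats every power of \<open>inverse h\<close>, and the left one
  is identically \<open>0\<close>.\<close>

lemma DERIV_flat:
  "(flat k has_real_derivative (flat (k + 2) t - real k * flat (k + 1) t)) (at t)"
proof -
  consider "t > 0" | "t < 0" | "t = 0"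
    by linarith
  then show ?thesis
  proof cases
    case 1
    \<comment> \<open>Handles the truncated exponent \<open>m - Suc 0\<close> of the power rule: the
      identity can fail only at \<open>m = 0\<close>, where that rule's factor \<open>m\<close> is
      zero.\<close>
    have pow: "x ^ m = x * x ^ (m - Suc 0) \<or> m = 0" for x :: real and m
      by (cases m) auto
    have der: "((\<lambda>t. inverse t ^ k * exp (- inverse t)) has_real_derivative
        (flat (k + 2) t - real k * flat (k + 1) t)) (at t)"
      using 1 by (cases k)
        (auto intro!: derivative_eq_intros simp: flat_def algebra_simps, use pow in blast)
    have "\<forall>\<^sub>F s in nhds t. flat k s = inverse s ^ k * exp (- inverse s)"
      using eventually_nhds_in_open[of "{0<..}" t] 1
      by (auto elim!: eventually_mono simp: flat_def)
    from DERIV_cong_ev[OF refl this refl] der show ?thesis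
      by (rule iffD2)
  next
    case 2
    have "\<forall>\<^sub>F s in nhds t. flat k s = 0"
      using eventually_nhds_in_open[of "{..<0}" t] 2
      by (auto elim!: eventually_mono simp: flat_def)
    from DERIV_cong_ev[OF refl this refl] DERIV_const have "(flat k has_real_derivative 0) (at t)"
      by (rule iffD2)
    then show ?thesis
      using 2 by (simp add: flat_def)
  next
    case 3
    have "((\<lambda>h::real. inverse h ^ k * exp (- inverse h) / h) \<longlongrightarrow> 0) (at_right 0)"
      by real_asymp
    moreover have "\<forall>\<^sub>F h in at_right 0. inverse h ^ k * exp (- inverse h) / h = flat k h / h"
      by (auto simp: eventually_at_filter flat_def)
    ultimately have "((\<lambda>h. flat k h / h) \<longlongrightarrow> 0) (at_right 0)"
      by (rule Lim_transform_eventually)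
    moreover have "((\<lambda>h. flat k h / h) \<longlongrightarrow> 0) (at_left 0)"
      by (rule Lim_transform_eventually[OF tendsto_const])
        (auto simp: eventually_at_filter flat_def)
    ultimately have "((\<lambda>h. flat k h / h) \<longlongrightarrow> 0) (at 0)"
      by (simp add: filterlim_split_at)
    then show ?thesis
      using 3 by (simp add: DERIV_def flat_def)
  qed
qed

lemma infinitely_differentiable_flat: "infinitely_differentiable (flat k)"
proof -
  have "n_times_differentiable n (flat k)" for n
  proof (induction n arbitrary: k)
    case 0
    show ?case
      using DERIV_flat[THEN DERIV_isCont] by (simp add: continuous_on_eq_continuous_at)
  next
    case (Suc n)
    have "n_times_differentiable n (\<lambda>t. flat (k + 2) t + (- real k) * flat (k + 1) t)"
      by (intro n_times_differentiable_add n_times_differentiable_mult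
          n_times_differentiable_const Suc)
    then show ?case
      by (intro n_times_differentiable_SucI_real[OF DERIV_flat]) simp
  qed
  then show ?thesis
    by (simp add: infinitely_differentiable_def)
qed

lemma flat_nonneg: "0 \<le> flat k t"
  by (simp add: flat_def)

lemma flat_0_le: "flat 0 t \<le> 1"
  by (simp add: flat_def)

text \<open>For \<open>k = 0\<close> the second term in \<open>DERIV_flat\<close> vanishes, so this
  bounds the derivative of \<open>flat 0\<close>. With \<open>s = inverse t\<close> it follows by
  squaring \<open>s / 2 \<le> exp (s / 2)\<close>.\<close>

lemma flat_2_le: "flat 2 t \<le> 4"
proof (cases "t > 0")
  case True
  define s where "s = inverse t"
  have "0 < s"
    using True by (simp add: s_def)
  then have "(s / 2)\<^sup>2 \<le> (exp (s / 2))\<^sup>2"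
    using exp_ge_add_one_self[of "s / 2"] by (intro power_mono) linarith+
  also have "\<dots> = exp s"
    by (simp add: power2_eq_square flip: exp_add)
  finally have "s\<^sup>2 * exp (- s) \<le> 4"
    by (simp add: exp_minus field_simps)
  then show ?thesis
    using True by (simp add: flat_def s_def)
qed (simp add: flat_def)

section \<open>Translation-invariant measures\<close>

text \<open>
  Both sides equal \<open>\<integral>\<integral> 1\<^sub>A(x) 1\<^sub>B(x + y) d\<mu>(x) dy\<close>.
\<close>

lemma translation_invariant_emeasure_mult:
  fixes \<mu> :: "real measure"
  assumes sets: "sets \<mu> = sets borel" and "sigma_finite_measure \<mu>"
    and inv: "\<And>y A. A \<in> sets borel \<Longrightarrow> emeasure \<mu> {x. x + y \<in> A} = emeasure \<mu> A"
    and A [measurable]: "A \<in> sets borel" and B [measurable]: "B \<in> sets borel"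
  shows "emeasure \<mu> A * emeasure lborel B = emeasure \<mu> B * emeasure lborel A"
proof -
  interpret \<mu>: sigma_finite_measure \<mu>
    by fact
  interpret pair_sigma_finite \<mu> lborel ..
  note sets [measurable_cong]
  have space: "space \<mu> = UNIV"
    using sets_eq_imp_space_eq[OF sets] by simp
  have lborel_shift: "emeasure lborel {y. x + y \<in> B} = emeasure lborel B" for x
  proof -
    have "emeasure lborel B = emeasure (distr lborel borel ((+) x)) B"
      by (simp add: lborel_distr_plus)
    also have "\<dots> = emeasure lborel {y. x + y \<in> B}"
      by (subst emeasure_distr) (auto simp: vimage_def)
    finally show ?thesis
      by simp
  qed
  have lborel_reflect: "emeasure lborel {y. x - y \<in> A} = emeasure lborel A" for x
  proof -
    have "emeasure lborel A = emeasure (distr lborel borel (\<lambda>y. x + (-1) *\<^sub>R y)) A"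
      by (subst lborel_affine[of "-1" x]) (auto simp: density_1)
    also have "\<dots> = emeasure lborel {y. x - y \<in> A}"
      by (subst emeasure_distr) (auto simp: vimage_def)
    finally show ?thesis
      by simp
  qed
  \<comment> \<open>The substitution \<open>z = x + y\<close> under \<mu>: the left integrand is the
    indicator of the preimage under this shift of the set whose indicator stands on the
    right.\<close>
  have shift_integral: "(\<integral>\<^sup>+x. indicator A x * indicator B (x + y) \<partial>\<mu>)
      = (\<integral>\<^sup>+x. indicator B x * indicator A (x - y) \<partial>\<mu>)" for y
  proof -
    have "(\<integral>\<^sup>+x. indicator A x * indicator B (x + y) \<partial>\<mu>)
        = (\<integral>\<^sup>+x. indicator {x. x + y \<in> {z. z \<in> B \<and> z - y \<in> A}} x \<partial>\<mu>)"
      by (intro nn_integral_cong) (auto simp: indicator_def)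
    also have "\<dots> = emeasure \<mu> {x. x + y \<in> {z. z \<in> B \<and> z - y \<in> A}}"
      by (intro nn_integral_indicator) (simp add: sets)
    also have "\<dots> = emeasure \<mu> {z. z \<in> B \<and> z - y \<in> A}"
      by (intro inv) measurable
    also have "\<dots> = (\<integral>\<^sup>+x. indicator {z. z \<in> B \<and> z - y \<in> A} x \<partial>\<mu>)"
      by (intro nn_integral_indicator[symmetric]) (simp add: sets)
    also have "\<dots> = (\<integral>\<^sup>+x. indicator B x * indicator A (x - y) \<partial>\<mu>)"
      by (intro nn_integral_cong) (auto simp: indicator_def)
    finally show ?thesis .
  qed
  \<comment> \<open>Used with \<open>f x y\<close> equal to \<open>x + y\<close> and to
    \<open>x - y\<close>; the two facts on \<open>lborel\<close> above then make the slice measure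
    independent of \<open>x\<close>.\<close>
  have slice: "(\<integral>\<^sup>+y. indicator C x * indicator D (f x y) \<partial>lborel)
      = emeasure lborel {y. f x y \<in> D} * indicator C x"
    if [measurable]: "f x \<in> borel_measurable borel" "D \<in> sets borel"
    for C D and x :: real and f :: "real \<Rightarrow> real \<Rightarrow> real"
  proof -
    have "(\<integral>\<^sup>+y. indicator C x * indicator D (f x y) \<partial>lborel)
        = (\<integral>\<^sup>+y. indicator C x * indicator {y. f x y \<in> D} y \<partial>lborel)"
      by (intro nn_integral_cong) (auto simp: indicator_def)
    also have "\<dots> = indicator C x * emeasure lborel {y. f x y \<in> D}"
      by (subst nn_integral_cmult_indicator) auto
    finally show ?thesis
      by (simp add: mult.commute)
  qed
  have "emeasure \<mu> A * emeasure lborel B = (\<integral>\<^sup>+x. emeasure lborel B * indicator A x \<partial>\<mu>)"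
    by (subst nn_integral_cmult_indicator) (auto simp: sets mult.commute)
  also have "\<dots> = (\<integral>\<^sup>+x. \<integral>\<^sup>+y. indicator A x * indicator B (x + y) \<partial>lborel \<partial>\<mu>)"
    by (simp add: slice lborel_shift)
  also have "\<dots> = (\<integral>\<^sup>+y. \<integral>\<^sup>+x. indicator A x * indicator B (x + y) \<partial>\<mu> \<partial>lborel)"
    by (rule Fubini'[symmetric]) measurable
  also have "\<dots> = (\<integral>\<^sup>+y. \<integral>\<^sup>+x. indicator B x * indicator A (x - y) \<partial>\<mu> \<partial>lborel)"
    by (simp only: shift_integral)
  also have "\<dots> = (\<integral>\<^sup>+x. \<integral>\<^sup>+y. indicator B x * indicator A (x - y) \<partial>lborel \<partial>\<mu>)"
    by (rule Fubini') measurable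
  also have "\<dots> = (\<integral>\<^sup>+x. emeasure lborel A * indicator B x \<partial>\<mu>)"
    by (simp add: slice lborel_reflect)
  also have "\<dots> = emeasure \<mu> B * emeasure lborel A"
    by (subst nn_integral_cmult_indicator) (auto simp: sets mult.commute)
  finally show ?thesis .
qed

text \<open>Comparison of \<open>B\<close> with the whole line excludes measure \<open>0\<close>. If
  \<open>B\<close> had infinite measure, every set of finite \<mu>-measure would be Lebesgue null,
  and countably many of them cover the line.\<close>

lemma translation_invariant_emeasure_pos_finite:
  fixes \<mu> :: "real measure"
  assumes sets: "sets \<mu> = sets borel" and sf: "sigma_finite_measure \<mu>"
    and nz: "emeasure \<mu> UNIV \<noteq> 0"
    and inv: "\<And>y A. A \<in> sets borel \<Longrightarrow> emeasure \<mu> {x. x + y \<in> A} = emeasure \<mu> A"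
    and B: "B \<in> sets borel" "emeasure lborel B \<noteq> 0" "emeasure lborel B \<noteq> \<infinity>"
  shows "emeasure \<mu> B \<noteq> 0" "emeasure \<mu> B \<noteq> \<infinity>"
proof -
  note eq = translation_invariant_emeasure_mult[OF sets sf inv _ B(1)]
  show "emeasure \<mu> B \<noteq> 0"
    using eq[of UNIV] nz B by auto
  show "emeasure \<mu> B \<noteq> \<infinity>"
  proof
    assume inf: "emeasure \<mu> B = \<infinity>"
    obtain A :: "nat \<Rightarrow> real set" where A: "range A \<subseteq> sets \<mu>" "(\<Union>i. A i) = space \<mu>"
      "\<And>i. emeasure \<mu> (A i) \<noteq> \<infinity>"
      using sigma_finite_measure.sigma_finite[OF sf] by metis
    have "emeasure lborel (A i) = 0" for i
    proof (rule ccontr)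
      assume "emeasure lborel (A i) \<noteq> 0"
      moreover have "A i \<in> sets borel"
        using A(1) sets by auto
      ultimately have "emeasure \<mu> (A i) * emeasure lborel B = \<infinity>"
        using eq[of "A i"] inf by (simp add: ennreal_top_mult)
      then show False
        using A(3)[of i] B(3) by (simp add: ennreal_mult_eq_top_iff)
    qed
    then have "emeasure lborel (\<Union>i. A i) = 0"
      using A(1) sets by (intro emeasure_UN_eq_0) auto
    then show False
      using A(2) sets_eq_imp_space_eq[OF sets] by simp
  qed
qed

section \<open>The loop\<close>

text \<open>\<open>sin 0 = 0\<close> and \<open>flat 0 0 = 0\<close> make \<open>0\<close> a
  two-sided identity. The divisor \<open>8\<close> turns the bound \<open>4\<close> on
  \<open>flat 2\<close> into a partial derivative of at least \<open>1 / 2\<close>.\<close>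

definition perturbed_add :: "real \<Rightarrow> real \<Rightarrow> real"
  where "perturbed_add a b = a + b + sin a * flat 0 (- b) / 8"

section \<open>Real functions with derivative bounded below\<close>

lemma increment_ge_if_DERIV_ge:
  fixes f :: "real \<Rightarrow> real"
  assumes "\<And>x. (f has_real_derivative f' x) (at x)" "\<And>x. c \<le> f' x" "x \<le> y"
  shows "c * (y - x) \<le> f y - f x"
proof (cases "x = y")
  case False
  then obtain z where "f y - f x = (y - x) * f' z"
    using MVT2[of x y f f'] assms by auto
  then show ?thesis
    using mult_right_mono[OF assms(2)[of z], of "y - x"] assms(3) by (simp add: mult.commute)
qed simp

text \<open>Yields injectivity, and has the shape of the hypothesis \<open>mono\<close> in
  \<open>infinitely_differentiable_implicit\<close>.\<close>

lemma expanding_if_DERIV_ge: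
  fixes f :: "real \<Rightarrow> real"
  assumes "\<And>x. (f has_real_derivative f' x) (at x)" "\<And>x. c \<le> f' x"
  shows "c * \<bar>x - y\<bar> \<le> \<bar>f x - f y\<bar>"
  using increment_ge_if_DERIV_ge[OF assms, of x y] increment_ge_if_DERIV_ge[OF assms, of y x]
  by (cases "x \<le> y") (auto simp: abs_if)

lemma ex1_if_DERIV_ge:
  fixes f :: "real \<Rightarrow> real"
  assumes der: "\<And>x. (f has_real_derivative f' x) (at x)" and ge: "\<And>x. c \<le> f' x" and "0 < c"
  shows "\<exists>!x. f x = b"
proof -
  \<comment> \<open>Growth at rate at least \<open>c\<close> carries \<open>f\<close> from
    \<open>f 0\<close> past \<open>b\<close> within distance \<open>r\<close>, so the intermediate
    value theorem applies on \<open>[- r, r]\<close>.\<close>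
  define r where "r = \<bar>b - f 0\<bar> / c"
  have r: "0 \<le> r" "c * r = \<bar>b - f 0\<bar>"
    using \<open>0 < c\<close> by (auto simp: r_def)
  have "\<exists>x. - r \<le> x \<and> x \<le> r \<and> f x = b"
    using increment_ge_if_DERIV_ge[OF der ge, of 0 r]
      increment_ge_if_DERIV_ge[OF der ge, of "- r" 0] r der
    by (intro IVT) (auto intro: DERIV_isCont)
  moreover have "x = y" if "f x = b" "f y = b" for x y
    using expanding_if_DERIV_ge[OF der ge, of x y] that \<open>0 < c\<close>
    by (simp add: mult_le_0_iff)
  ultimately show ?thesis
    by blast
qed

section \<open>Partial derivatives and smoothness of the multiplication\<close>

lemma DERIV_perturbed_add_left:
  "((\<lambda>x. perturbed_add x b) has_real_derivative (1 + cos x * flat 0 (- b) / 8)) (at x)"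
  unfolding perturbed_add_def by (auto intro!: derivative_eq_intros)

lemma DERIV_perturbed_add_right:
  "(perturbed_add a has_real_derivative (1 - sin a * flat 2 (- x) / 8)) (at x)"
proof -
  have "((\<lambda>x. flat 0 (- x)) has_real_derivative - flat 2 (- x)) (at x)"
    using DERIV_flat[of 0 "- x"] by (simp add: numeral_2_eq_2 flip: DERIV_mirror)
  then show ?thesis
    unfolding perturbed_add_def by (auto intro!: derivative_eq_intros)
qed

lemma DERIV_perturbed_add_ge:
  "1 / 2 \<le> 1 + cos x * flat 0 (- b) / 8"
  "1 / 2 \<le> 1 - sin a * flat 2 (- x) / 8"
proof -
  have "\<bar>cos x * flat 0 (- b)\<bar> \<le> 1 * 1"
    unfolding abs_mult using flat_nonneg flat_0_le by (intro mult_mono) auto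
  then show "1 / 2 \<le> 1 + cos x * flat 0 (- b) / 8"
    by linarith
  have "\<bar>sin a * flat 2 (- x)\<bar> \<le> 1 * 4"
    unfolding abs_mult using flat_nonneg flat_2_le by (intro mult_mono) auto
  then show "1 / 2 \<le> 1 - sin a * flat 2 (- x) / 8"
    by linarith
qed

text \<open>Arbitrary linear \<open>f\<close> and \<open>g\<close> cover both orders of the
  arguments: right division solves for the first factor, so there the coordinates are
  swapped.\<close>

lemma infinitely_differentiable_perturbed_add_compose:
  fixes f g :: "'a::real_normed_vector \<Rightarrow> real"
  assumes "bounded_linear f" "bounded_linear g"
  shows "infinitely_differentiable (\<lambda>p. perturbed_add (f p) (g p))"
proof -
  have "n_times_differentiable n
    (\<lambda>p. f p + g p + sin (f p) * flat 0 (- 1 * g p) * (1 / 8))" for n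
  proof -
    have f: "n_times_differentiable n f" and g: "n_times_differentiable n g"
      using assms by (auto intro: n_times_differentiable_bounded_linear)
    have "n_times_differentiable n (sin :: real \<Rightarrow> real)" "n_times_differentiable n (flat 0)"
      using infinitely_differentiable_sin infinitely_differentiable_flat
      by (auto simp: infinitely_differentiable_def)
    note outer = this[THEN n_times_differentiable_compose]
    have "n_times_differentiable n (\<lambda>p. sin (f p))"
      by (rule outer(1)[OF f])
    moreover have "n_times_differentiable n (\<lambda>p. flat 0 (- 1 * g p))"
      by (rule outer(2)[OF n_times_differentiable_mult[OF n_times_differentiable_const g]])
    ultimately have "n_times_differentiable n (\<lambda>p. sin (f p) * flat 0 (- 1 * g p) * (1 / 8))"
      by (rule n_times_differentiable_mult[OF n_times_differentiable_mult
            n_times_differentiable_const])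
    then show ?thesis
      by (rule n_times_differentiable_add[OF n_times_differentiable_add[OF f g]])
  qed
  then show ?thesis
    by (simp add: infinitely_differentiable_def perturbed_add_def)
qed

section \<open>Loop axioms and smoothness of the divisions\<close>

interpretation perturbed_add: loop perturbed_add 0
proof
  show "\<exists>!x. perturbed_add a x = b" for a b
    using DERIV_perturbed_add_right DERIV_perturbed_add_ge(2) by (rule ex1_if_DERIV_ge) simp
  show "\<exists>!x. perturbed_add x a = b" for a b
    using DERIV_perturbed_add_left DERIV_perturbed_add_ge(1) by (rule ex1_if_DERIV_ge) simp
qed (auto simp: perturbed_add_def flat_def)

lemma smooth_loop_perturbed_add: "smooth_loop perturbed_add 0"
proof
  show "infinitely_differentiable (\<lambda>(a, b). perturbed_add a b)"
    using infinitely_differentiable_perturbed_add_compose[OF bounded_linear_fst bounded_linear_snd]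
    by (simp add: case_prod_unfold)
  show "infinitely_differentiable (\<lambda>(a, b). perturbed_add.ldiv a b)"
  proof (rule infinitely_differentiable_implicit)
    show "infinitely_differentiable (\<lambda>p. perturbed_add (fst p) (snd p))"
      by (intro infinitely_differentiable_perturbed_add_compose bounded_linear_fst bounded_linear_snd)
    show "1 / 2 * \<bar>x - y\<bar> \<le> \<bar>perturbed_add (fst (a, x)) (snd (a, x))
        - perturbed_add (fst (a, y)) (snd (a, y))\<bar>" for a x y
      using expanding_if_DERIV_ge[OF DERIV_perturbed_add_right DERIV_perturbed_add_ge(2)] by simp
    show "perturbed_add (fst (a, case (a, b) of (a, b) \<Rightarrow> perturbed_add.ldiv a b))
        (snd (a, case (a, b) of (a, b) \<Rightarrow> perturbed_add.ldiv a b)) = b" for a b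
      using theI'[OF perturbed_add.ex1_right_factor] by (simp add: perturbed_add.ldiv_def)
  qed simp
  show "infinitely_differentiable (\<lambda>(a, b). perturbed_add.rdiv a b)"
  proof (rule infinitely_differentiable_implicit)
    show "infinitely_differentiable (\<lambda>p. perturbed_add (snd p) (fst p))"
      by (intro infinitely_differentiable_perturbed_add_compose bounded_linear_fst bounded_linear_snd)
    show "1 / 2 * \<bar>x - y\<bar> \<le> \<bar>perturbed_add (snd (a, x)) (fst (a, x))
        - perturbed_add (snd (a, y)) (fst (a, y))\<bar>" for a x y
      using expanding_if_DERIV_ge[OF DERIV_perturbed_add_left DERIV_perturbed_add_ge(1)] by simp
    show "perturbed_add (snd (a, case (a, b) of (a, b) \<Rightarrow> perturbed_add.rdiv a b))
        (fst (a, case (a, b) of (a, b) \<Rightarrow> perturbed_add.rdiv a b)) = b" for a b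
      using theI'[OF perturbed_add.ex1_left_factor] by (simp add: perturbed_add.rdiv_def)
  qed simp
qed

section \<open>Nonexistence of an invariant right measure\<close>

lemma not_invariant_right_measure_perturbed_add:
  "\<not> invariant_right_measure perturbed_add \<mu>"
proof
  assume "invariant_right_measure perturbed_add \<mu>"
  then have sets: "sets \<mu> = sets borel" and sf: "sigma_finite_measure \<mu>"
    and nz: "emeasure \<mu> UNIV \<noteq> 0"
    and inv: "\<And>u A. A \<in> sets borel \<Longrightarrow> emeasure \<mu> {\<theta>. perturbed_add \<theta> u \<in> A} = emeasure \<mu> A"
    by (auto simp: invariant_right_measure_def)
  have pos: "emeasure \<mu> {x. x + y \<in> A} = emeasure \<mu> A"
    if "A \<in> sets borel" "0 \<le> y" for y A
    using inv[OF that(1), of y] that(2) by (simp add: perturbed_add_def flat_def)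
  have trans: "emeasure \<mu> {x. x + y \<in> A} = emeasure \<mu> A"
    if [measurable]: "A \<in> sets borel" for y A
  proof (cases "0 \<le> y")
    case False
    \<comment> \<open>For negative \<open>y\<close>, shifting the set
      \<open>{x. x + y \<in> A}\<close> by the positive amount \<open>- y\<close> gives back
      \<open>A\<close>.\<close>
    have "{x. x + y \<in> A} \<in> sets borel"
      by measurable
    from pos[OF this, of "- y"] False show ?thesis
      by simp
  qed (simp add: pos that)
  \<comment> \<open>On \<open>[0, pi / 2]\<close> the sine rises from \<open>0\<close> to
    \<open>1\<close>, and \<open>flat 0 1 = exp (- 1)\<close>, so this right translation lengthens
    the interval by \<open>exp (- 1) / 8\<close>.\<close>
  define R where "R x = perturbed_add x (- 1)" for x
  define I where "I = {0<..<pi / 2}"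
  define J where "J = {R 0<..<R (pi / 2)}"
  have "R x < R y" if "x < y" for x y
    using that
      increment_ge_if_DERIV_ge[OF DERIV_perturbed_add_left DERIV_perturbed_add_ge(1), of x y "- 1"]
    by (simp add: R_def)
  then have "R x < R y \<longleftrightarrow> x < y" for x y
    by (metis linorder_neqE order_less_asym)
  then have "{x. R x \<in> J} = I"
    by (auto simp: I_def J_def)
  then have eq: "emeasure \<mu> I = emeasure \<mu> J"
    using inv[of J "- 1"] by (simp add: R_def J_def)
  have len: "R (pi / 2) - R 0 = pi / 2 + exp (- 1) / 8"
    by (simp add: R_def perturbed_add_def flat_def)
  have I: "I \<in> sets borel" "emeasure lborel I = ennreal (pi / 2)"
    by (auto simp: I_def)
  have "R 0 \<le> R (pi / 2)"
    using len pi_ge_zero exp_ge_zero[of "- 1 :: real"] by linarith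
  then have J: "J \<in> sets borel" "emeasure lborel J = ennreal (pi / 2 + exp (- 1) / 8)"
    using len by (auto simp: J_def)
  \<comment> \<open>Needed to cancel \<open>emeasure \<mu> I\<close> from the proportionality with
    Lebesgue measure, leaving equal lengths for \<open>I\<close> and \<open>J\<close>.\<close>
  have fin: "emeasure \<mu> I \<noteq> 0" "emeasure \<mu> I \<noteq> \<infinity>"
    using translation_invariant_emeasure_pos_finite[OF sets sf nz trans I(1)] pi_gt_zero
    by (auto simp: I(2) ennreal_eq_0_iff not_le)
  have "emeasure \<mu> I * ennreal (pi / 2 + exp (- 1) / 8) = emeasure \<mu> I * ennreal (pi / 2)"
    using translation_invariant_emeasure_mult[OF sets sf trans I(1) J(1)] by (simp add: eq I(2) J(2))
  then have "ennreal (pi / 2 + exp (- 1) / 8) = ennreal (pi / 2)"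
    using fin by (simp add: ennreal_mult_cancel_left)
  then show False
    by (subst (asm) ennreal_inj) (auto intro: add_nonneg_nonneg)
qed

theorem theorem3:
  "\<exists>(mul :: real \<Rightarrow> real \<Rightarrow> real) (e :: real).
     smooth_loop mul e \<and> (\<nexists>\<mu>. invariant_right_measure mul \<mu>)"
  using smooth_loop_perturbed_add not_invariant_right_measure_perturbed_add by blast

end
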